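(* Let $F$ be a probability distribution on $\mathbb{R}\cup\{-\infty\}$ such that $F([1-\epsilon,1])>0$ for all $\epsilon>0$ and $F((1,\infty))=0$. Let $\ell\in[0,1)$ be such that $F([1-\ell,1])>0$. Let $(w_j(t),\,j\ge1,\,t\in\mathbb{Z})$ be i.i.d. random variables with law $F$, and write $w(t)=(w_1(t),w_2(t),\ldots)$. Let $(\overline{\mathfrak m}(t),\,t\in\mathbb{Z})$ be the stationary process constructed from $(w(t),\,t\in\mathbb{Z})$ and $\ell$ as described in the context. Define $$T^*:=\sup\Big\{t\le-1:\ w_1(t)\ge\ell,\ \min_{1\le j\le|t|}\overline{w}(t;j)\ge1-\ell\Big\}.$$ Then $|T^*|<\infty$ almost surely, and $$\overline{\mathfrak m}(0)=\mathfrak m\big(\sigma\Psi_w^{T^*,-1}\delta_0,\,w(0)\big)\quad\text{almost surely}.$$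
   Context: Convention: $-\infty+x=-\infty$ for all $x\in\mathbb{R}\cup\{-\infty\}$. Point measures. $\mathcal{N}$ is the set of locally finite point measures $\nu$ on $\mathbb{R}\cup\{-\infty\}$ with a finite maximal element, i.e. measures with nonnegative integer values that are finite on every interval $[x,\infty)$, $x\in\mathbb{R}$, and whose largest atom, if $\nu\ne0$, is a real number. Such a $\nu$ is identified with the (finite or infinite) nonincreasing sequence $\nu_1\ge\nu_2\ge\cdots\ge-\infty$ of the locations of its atoms, counted with multiplicity. Its number of atoms is $\|\nu\|$. Charges and dynamics. $\mathcal{W}$ is the set of sequences $w=(w_1,w_2,\ldots)$ in $\mathbb{R}\cup\{-\infty\}$ with $\sup_k w_k\le 1$. For $\nu\in\mathcal{N}$, $\nu\neq0$, and $w\in\mathcal{W}$, set $\mathfrak m(\nu,w):=\sup_k(\nu_k+w_k)$, the supremum being over all $k\ge1$ if $\|\nu\|=\infty$ and over $1\le k\le\|\nu\|$ otherwise, and $\Psi_w\nu:=\nu+\delta_{\mathfrak m(\nu,w)}$. For integers $s\le t$, $\Psi_w^{s,t}:=\Psi_{w(t)}\circ\Psi_{w(t-1)}\circ\cdots\circ\Psi_{w(s)}$. For nonzero $\nu\in\mathcal{N}$, $\sigma\nu$ is the translate of $\nu$ by $-\nu_1$ (so its largest atom is at $0$). For $T\in\mathbb{Z}$ and integers $t\ge1$, $\overline{w}(T;t):=\max\{w_1(T+t),\ldots,w_t(T+t)\}$. The stationary process $\overline{\mathfrak m}$. For $k\in\mathbb{Z}$ let $R_k$ be the event that $w_1(k)\ge\ell$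 and $\overline{w}(k;j)\ge1-\ell$ for all $j\ge1$. The stationary random set $J:=\{k\in\mathbb{Z}: R_k\text{ holds}\}$ is almost surely unbounded above and below; enumerate its elements as $\cdots<T_{-1}<T_0\le0<T_1<T_2<\cdots$. For $t\in\mathbb{Z}$, let $i$ be the unique index with $T_i<t\le T_{i+1}$ and set $\tilde\nu(t):=\sigma\Psi_w^{T_i,t}\delta_0$. Finally, $\overline{\mathfrak m}(t):=\mathfrak m(\tilde\nu(t-1),w(t))$, $t\in\mathbb{Z}$. *)

theory Defs
  imports "HOL-Probability.Probability"
begin

text \<open>
  The space of all reals together with minus infinity is represented inside \<^typ>\<open>ereal\<close>; measures on
  it are Borel measures on \<^typ>\<open>ereal\<close> that do not charge plus infinity. Away from plus infinity the
  addition of \<^typ>\<open>ereal\<close> obeys the convention that minus infinity is absorbing.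
  Sequences of charges have type \<^typ>\<open>nat \<Rightarrow> ereal\<close>; index 0 is never used.
\<close>

section \<open>Point measures\<close>

definition num_atoms :: "ereal measure \<Rightarrow> ennreal" where
  "num_atoms \<nu> = emeasure \<nu> (space \<nu>)"

text \<open>
  The location of the \<open>k\<close>-th largest atom, counted with multiplicity, for \<open>1 \<le> k \<le> num_atoms \<nu>\<close>: the
  largest \<open>x\<close> such that at least \<open>k\<close> atoms lie in the half-line from \<open>x\<close> upwards.
\<close>

definition atom :: "ereal measure \<Rightarrow> nat \<Rightarrow> ereal" where
  "atom \<nu> k = Sup {x. of_nat k \<le> emeasure \<nu> {x..}}"

definition point_measures :: "ereal measure set" where
  "point_measures = {\<nu>. sets \<nu> = sets borel \<and>
     (\<forall>A\<in>sets \<nu>. \<exists>n::enat. emeasure \<nu> A = ennreal_of_enat n) \<and>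
     emeasure \<nu> {\<infinity>} = 0 \<and>
     (\<forall>x::real. emeasure \<nu> {ereal x..<\<infinity>} < \<infinity>) \<and>
     (num_atoms \<nu> \<noteq> 0 \<longrightarrow> \<bar>atom \<nu> 1\<bar> \<noteq> \<infinity>)}"

definition add_measure :: "'a measure \<Rightarrow> 'a measure \<Rightarrow> 'a measure" where
  "add_measure M N = measure_of (space M) (sets M) (\<lambda>A. emeasure M A + emeasure N A)"

text \<open>Translation by minus the largest atom; only meaningful for nonzero \<open>\<nu>\<close>.\<close>

definition recentre :: "ereal measure \<Rightarrow> ereal measure" where
  "recentre \<nu> = distr \<nu> borel (\<lambda>x. x - atom \<nu> 1)"

section \<open>Charges and dynamics\<close>

definition charges :: "(nat \<Rightarrow> ereal) set" where
  "charges = {w. (SUP k\<in>{1..}. w k) \<le> 1}"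

definition max_charged :: "ereal measure \<Rightarrow> (nat \<Rightarrow> ereal) \<Rightarrow> ereal" where
  "max_charged \<nu> w = (SUP k\<in>{k. 1 \<le> k \<and> of_nat k \<le> num_atoms \<nu>}. atom \<nu> k + w k)"

definition Psi :: "(nat \<Rightarrow> ereal) \<Rightarrow> ereal measure \<Rightarrow> ereal measure" where
  "Psi w \<nu> = add_measure \<nu> (return borel (max_charged \<nu> w))"

text \<open>For \<open>s \<le> t\<close>, the step at time \<open>s\<close> is performed first and the one at time \<open>t\<close> last.\<close>

definition Psi_between ::
    "(int \<Rightarrow> nat \<Rightarrow> ereal) \<Rightarrow> int \<Rightarrow> int \<Rightarrow> ereal measure \<Rightarrow> ereal measure" where
  "Psi_between w s t = fold (\<lambda>r. Psi (w r)) [s..t]"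

definition wbar :: "(int \<Rightarrow> nat \<Rightarrow> ereal) \<Rightarrow> int \<Rightarrow> nat \<Rightarrow> ereal" where
  "wbar w T t = (MAX j\<in>{1..t}. w (T + int t) j)"

section \<open>The stationary process\<close>

text \<open>Below, \<open>w\<close> is one realisation of the array of charges.\<close>

definition renewal :: "(int \<Rightarrow> nat \<Rightarrow> ereal) \<Rightarrow> real \<Rightarrow> int \<Rightarrow> bool" where
  "renewal w l k \<longleftrightarrow> w k 1 \<ge> ereal l \<and> (\<forall>j\<ge>1. wbar w k j \<ge> ereal (1 - l))"

definition renewal_set :: "(int \<Rightarrow> nat \<Rightarrow> ereal) \<Rightarrow> real \<Rightarrow> int set" where
  "renewal_set w l = {k. renewal w l k}"

text \<open>
  The increasing enumeration of the renewal set, and the index of the last renewal time before \<open>t\<close>.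
  Both descriptions are uniquely satisfied when the renewal set is unbounded above and below.
\<close>

definition renewal_time :: "(int \<Rightarrow> nat \<Rightarrow> ereal) \<Rightarrow> real \<Rightarrow> int \<Rightarrow> int" where
  "renewal_time w l =
     (THE T. strict_mono T \<and> range T = renewal_set w l \<and> T 0 \<le> 0 \<and> 0 < T 1)"

definition renewal_index :: "(int \<Rightarrow> nat \<Rightarrow> ereal) \<Rightarrow> real \<Rightarrow> int \<Rightarrow> int" where
  "renewal_index w l t =
     (THE i. renewal_time w l i < t \<and> t \<le> renewal_time w l (i + 1))"

definition nu_tilde :: "(int \<Rightarrow> nat \<Rightarrow> ereal) \<Rightarrow> real \<Rightarrow> int \<Rightarrow> ereal measure" where
  "nu_tilde w l t =
     recentre (Psi_between w (renewal_time w l (renewal_index w l t)) t (return borel 0))"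

definition mbar :: "(int \<Rightarrow> nat \<Rightarrow> ereal) \<Rightarrow> real \<Rightarrow> int \<Rightarrow> ereal" where
  "mbar w l t = max_charged (nu_tilde w l (t - 1)) (w t)"

text \<open>The supremum is taken in \<^typ>\<open>ereal\<close>, so that it is minus infinity for the empty set.
  The set is bounded above, so a finite supremum is attained and is an integer.\<close>

definition T_star :: "(int \<Rightarrow> nat \<Rightarrow> ereal) \<Rightarrow> real \<Rightarrow> ereal" where
  "T_star w l = (SUP t\<in>{t::int. t \<le> -1 \<and> w t 1 \<ge> ereal l \<and>
                    (MIN j\<in>{1..nat \<bar>t\<bar>}. wbar w t j) \<ge> ereal (1 - l)}. ereal (of_int t))"

section \<open>Well-definedness of the dynamics\<close>

lemma sets_add_measure [simp]: "sets (add_measure M N) = sets M"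
  by (simp add: add_measure_def)

lemma space_add_measure [simp]: "space (add_measure M N) = space M"
  by (simp add: add_measure_def)

lemma emeasure_add_measure:
  assumes "sets N = sets M" "A \<in> sets M"
  shows "emeasure (add_measure M N) A = emeasure M A + emeasure N A"
proof -
  have "countably_additive (sets M) (\<lambda>A. emeasure M A + emeasure N A)"
    using assms(1) by (auto simp: countably_additive_def suminf_add[symmetric] suminf_emeasure)
  moreover have "positive (sets M) (\<lambda>A. emeasure M A + emeasure N A)"
    by (simp add: positive_def)
  ultimately show ?thesis
    using assms(2) unfolding add_measure_def
    by (intro emeasure_measure_of_sigma sets.sigma_algebra_axioms)
qed

lemma return_in_point_measures: "return borel (ereal x) \<in> point_measures"
proof -
  have "{y. 1 \<le> (indicator {y..} (ereal x) :: ennreal)} = {..ereal x}"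
    by (auto simp: indicator_def)
  then have "atom (return borel (ereal x)) 1 = ereal x"
    by (simp add: atom_def)
  moreover have "\<exists>n. indicator A (ereal x) = ennreal_of_enat n" for A
    by (cases "ereal x \<in> A") (auto intro: exI[of _ 0] exI[of _ 1])
  ultimately show ?thesis
    by (auto simp: point_measures_def indicator_def less_top)
qed

lemma Psi_in_point_measures:
  assumes \<nu>: "\<nu> \<in> point_measures" "num_atoms \<nu> \<noteq> 0" and w: "w \<in> charges"
  shows "Psi w \<nu> \<in> point_measures" "num_atoms (Psi w \<nu>) = num_atoms \<nu> + 1"
proof -
  define m where "m = max_charged \<nu> w"
  have sets: "sets \<nu> = sets borel" and int: "\<And>A. A \<in> sets \<nu> \<Longrightarrow> \<exists>n. emeasure \<nu> A = ennreal_of_enat n"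
    and inf: "emeasure \<nu> {\<infinity>} = 0" and fin: "\<And>x. emeasure \<nu> {ereal x..<\<infinity>} < \<infinity>"
    and real: "\<bar>atom \<nu> 1\<bar> \<noteq> \<infinity>"
    using \<nu> by (auto simp: point_measures_def)
  have E: "emeasure (Psi w \<nu>) A = emeasure \<nu> A + indicator A m" if "A \<in> sets borel" for A
    using that sets by (simp add: Psi_def m_def emeasure_add_measure)
  have sets': "sets (Psi w \<nu>) = sets borel" using sets by (simp add: Psi_def)
  have sp: "space (Psi w \<nu>) = UNIV" "space \<nu> = UNIV"
    using sets_eq_imp_space_eq[OF sets'] sets_eq_imp_space_eq[OF sets] by auto
  show "num_atoms (Psi w \<nu>) = num_atoms \<nu> + 1"
    by (simp add: num_atoms_def sp E)
  have "m \<le> atom \<nu> 1 + 1"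
    unfolding m_def max_charged_def
  proof (rule SUP_least, clarify)
    fix k :: nat assume k: "1 \<le> k"
    have "atom \<nu> k \<le> atom \<nu> 1"
      unfolding atom_def using k
      by (intro Sup_subset_mono) (auto intro: order_trans[rotated])
    moreover have "w k \<le> 1"
      using w k by (auto simp: charges_def SUP_le_iff)
    ultimately show "atom \<nu> k + w k \<le> atom \<nu> 1 + 1" by (rule add_mono)
  qed
  then have m: "m \<noteq> \<infinity>" using real by (cases "atom \<nu> 1") auto
  have "{x. 1 \<le> emeasure \<nu> {x..} + indicator {x..} m} = {x. 1 \<le> emeasure \<nu> {x..}} \<union> {..m}"
    by (auto simp: indicator_def split: if_splits)
  then have "atom (Psi w \<nu>) 1 = max (atom \<nu> 1) m"
    by (simp add: atom_def E Sup_union_distrib sup_max)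
  then have "\<bar>atom (Psi w \<nu>) 1\<bar> \<noteq> \<infinity>"
    using m real by (auto simp: max_def)
  moreover have "\<exists>n. emeasure (Psi w \<nu>) A = ennreal_of_enat n" if A: "A \<in> sets borel" for A
  proof -
    obtain n where "emeasure \<nu> A = ennreal_of_enat n" using int A sets by blast
    then have "emeasure (Psi w \<nu>) A = ennreal_of_enat (n + (if m \<in> A then 1 else 0))"
      using A by (cases n) (auto simp: E indicator_def one_enat_def)
    then show ?thesis by blast
  qed
  ultimately show "Psi w \<nu> \<in> point_measures"
    using sets' inf fin m by (auto simp: point_measures_def E indicator_def)
qed

end

theory Submission imports Defs begin

text \<open>
  At a time \<open>T\<close> with \<open>w\<^sub>1(T) \<ge> l\<close> the new atom lands at distance at least \<open>l\<close> above all older ones.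
  As long as \<open>wbar(T; j) \<ge> 1 - l\<close>, one of the atoms born since \<open>T\<close> beats every older one, since charges
  are at most \<open>1\<close>. Hence the atoms born since \<open>T\<close> evolve autonomously, up to a translation, whatever
  the configuration before \<open>T\<close> was. Applied with \<open>T = T_star\<close>, which is not before the last renewal
  time \<open>r < -1\<close>, this shows that the dynamics started at \<open>r\<close> and at \<open>T_star\<close> give the same value at
  time \<open>0\<close>.

  For almost sure unboundedness of the renewal set in both directions, truncate the renewal events at
  the sparse times \<open>\<plusminus>(n + 1)\<^sup>2\<close> to the horizon \<open>n\<close>. The truncated events are independent with
  probability bounded below, so infinitely many of them occur, and the truncation errors are
  summable, so all but finitely many of those are true renewals.
\<close>

section \<open>Atoms under the dynamics\<close>

text \<open>A down-closed set either contains \<open>m\<close>, and then the cut is all of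
  \<open>{..m}\<close>, or lies entirely below \<open>m\<close>. The sets whose suprema define
  \<open>atom\<close> are down-closed, so this computes the effect of inserting one atom.\<close>

lemma Sup_Int_atMost:
  fixes S :: "'a::complete_linorder set"
  assumes "\<And>x y. y \<in> S \<Longrightarrow> x \<le> y \<Longrightarrow> x \<in> S"
  shows "Sup (S \<inter> {..m}) = min (Sup S) m"
proof (cases "m \<in> S")
  case True
  then have "Sup (S \<inter> {..m}) = m" by (intro Sup_eqI) auto
  then show ?thesis using True by (simp add: Sup_upper min_absorb2)
next
  case False
  then have "\<forall>x\<in>S. x \<le> m" using assms by (meson linear)
  then have "S \<inter> {..m} = S" "Sup S \<le> m" by (auto intro: Sup_least)
  then show ?thesis by (simp add: min_absorb1)
qed

lemma emeasure_atLeast_antimono: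
  assumes "sets \<nu> = sets (borel :: ereal measure)" "x \<le> y"
  shows "emeasure \<nu> {y..} \<le> emeasure \<nu> {x..}"
  using assms by (intro emeasure_mono) auto

text \<open>With \<open>k = 0\<close> the defining condition is vacuous. The value \<infinity> makes
  the insertion formula below valid for the top atom as well.\<close>

lemma atom_0 [simp]: "atom \<nu> 0 = \<infinity>"
  by (simp add: atom_def top_ereal_def)

lemma atom_antimono:
  assumes "j \<le> k"
  shows "atom \<nu> k \<le> atom \<nu> j"
proof -
  have "(of_nat j :: ennreal) \<le> of_nat k" using assms by simp
  then show ?thesis unfolding atom_def by (intro Sup_subset_mono) (blast intro: order_trans)
qed

lemma atom_beyond_num_atoms:
  assumes "sets \<nu> = sets borel" "\<not> of_nat k \<le> num_atoms \<nu>"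
  shows "atom \<nu> k = -\<infinity>"
proof -
  have "emeasure \<nu> {x..} \<le> num_atoms \<nu>" for x
    unfolding num_atoms_def using assms(1) by (simp add: emeasure_space)
  then have "{x. of_nat k \<le> emeasure \<nu> {x..}} = {}" using assms(2) by (auto dest: order_trans)
  then show ?thesis by (simp add: atom_def bot_ereal_def)
qed

lemma atom_return: "atom (return borel (ereal x)) 1 = ereal x"
proof -
  have "{y. 1 \<le> (indicator {y..} (ereal x) :: ennreal)} = {..ereal x}"
    by (auto simp: indicator_def)
  then show ?thesis by (simp add: atom_def)
qed

lemma sets_Psi [simp]: "sets (Psi w \<nu>) = sets \<nu>"
  by (simp add: Psi_def)

text \<open>Inserting \<open>m\<close> leaves \<open>Suc k\<close> atoms in \<open>{x..}\<close>
  exactly if there were already \<open>Suc k\<close>, or there were \<open>k\<close> and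
  \<open>x \<le> m\<close>. The union of these two sets of \<open>x\<close> becomes a
  \<open>max\<close> of suprema, the cut at \<open>m\<close> a \<open>min\<close>.\<close>

lemma atom_Psi:
  assumes "sets \<nu> = sets borel"
  shows "atom (Psi w \<nu>) (Suc k) = max (atom \<nu> (Suc k)) (min (atom \<nu> k) (max_charged \<nu> w))"
proof -
  define m where "m = max_charged \<nu> w"
  let ?S = "\<lambda>k. {x. of_nat k \<le> emeasure \<nu> {x..}}"
  have E: "emeasure (Psi w \<nu>) {x..} = emeasure \<nu> {x..} + indicator {x..} m" for x
    using assms by (simp add: Psi_def m_def emeasure_add_measure)
  have "{x. of_nat (Suc k) \<le> emeasure (Psi w \<nu>) {x..}} = ?S (Suc k) \<union> (?S k \<inter> {..m})"
    by (auto simp: E indicator_def add.commute[of 1] split: if_splits intro: order_trans[rotated])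
  moreover have "Sup (?S k \<inter> {..m}) = min (Sup (?S k)) m"
    using emeasure_atLeast_antimono[OF assms] by (intro Sup_Int_atMost) (auto intro: order_trans)
  ultimately show ?thesis by (simp add: atom_def Sup_union_distrib sup_max m_def)
qed

text \<open>Ranks beyond the number of atoms contribute -\<infinity>, since a charge bounded by 1 is
  never +\<infinity>. From here on the number of atoms need not be tracked.\<close>

lemma max_charged_eq:
  assumes "sets \<nu> = sets borel" "\<forall>k\<ge>1. w k \<le> 1"
  shows "max_charged \<nu> w = (SUP k\<in>{1..}. atom \<nu> k + w k)" (is "_ = ?S")
proof (rule antisym)
  show "max_charged \<nu> w \<le> ?S"
    unfolding max_charged_def by (intro SUP_subset_mono) auto
  show "?S \<le> max_charged \<nu> w"
  proof (rule SUP_least)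
    fix k :: nat assume k: "k \<in> {1..}"
    show "atom \<nu> k + w k \<le> max_charged \<nu> w"
    proof (cases "of_nat k \<le> num_atoms \<nu>")
      case True
      then show ?thesis unfolding max_charged_def using k by (intro SUP_upper) auto
    next
      case False
      moreover have "w k \<noteq> \<infinity>" using assms(2) k by auto
      ultimately show ?thesis using atom_beyond_num_atoms[OF assms(1)] by (cases "w k") auto
    qed
  qed
qed

lemma max_charged_le:
  assumes "sets \<nu> = sets borel" "\<forall>k\<ge>1. w k \<le> 1"
  shows "max_charged \<nu> w \<le> atom \<nu> 1 + 1"
  using assms(2) by (auto simp: max_charged_eq[OF assms] intro!: SUP_least add_mono atom_antimono)

lemma max_charged_ge:
  assumes "sets \<nu> = sets borel" "\<forall>k\<ge>1. w k \<le> 1" "1 \<le> k"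
  shows "atom \<nu> k + w k \<le> max_charged \<nu> w"
  using assms(3) by (auto simp: max_charged_eq[OF assms(1,2)] intro!: SUP_upper)

lemma atom_Psi_1_finite:
  assumes "sets \<nu> = sets borel" "\<forall>k\<ge>1. w k \<le> 1" "\<bar>atom \<nu> 1\<bar> \<noteq> \<infinity>"
  shows "\<bar>atom (Psi w \<nu>) 1\<bar> \<noteq> \<infinity>"
proof -
  have "max_charged \<nu> w \<noteq> \<infinity>"
    using max_charged_le[OF assms(1,2)] assms(3) by (cases "atom \<nu> 1") auto
  then show ?thesis using assms(3) atom_Psi[OF assms(1), of w 0] by (auto simp: max_def)
qed

text \<open>Translation by a real number is an order isomorphism, so it carries the set defining
  each atom onto the corresponding set of the translated measure.\<close>

lemma atom_recentre:
  assumes "sets \<nu> = sets borel" "\<bar>atom \<nu> 1\<bar> \<noteq> \<infinity>"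
  shows "atom (recentre \<nu>) k = atom \<nu> k - atom \<nu> 1"
proof -
  obtain a where a: "atom \<nu> 1 = ereal a" using assms(2) by auto
  let ?S = "{y. of_nat k \<le> emeasure \<nu> {y..}}"
  have "(\<lambda>x. x - ereal a) -` {x..} = {x + ereal a..}" for x
    by (auto simp: ereal_le_minus)
  moreover have "(\<lambda>x. x - ereal a) \<in> \<nu> \<rightarrow>\<^sub>M borel"
    using assms(1) by (subst measurable_cong_sets[OF assms(1) refl]) measurable
  ultimately have E: "emeasure (recentre \<nu>) {x..} = emeasure \<nu> {x + ereal a..}" for x
    using assms(1) sets_eq_imp_space_eq[OF assms(1)] unfolding recentre_def a
    by (subst emeasure_distr) auto
  have "x \<in> (\<lambda>y. y + ereal (- a)) ` ?S" if "x + ereal a \<in> ?S" for x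
    using that by (intro image_eqI[of _ _ "x + ereal a"]) (cases x, auto)
  moreover have "y + ereal (- a) + ereal a = y" for y by (cases y) auto
  ultimately have "{x. of_nat k \<le> emeasure (recentre \<nu>) {x..}} = (\<lambda>y. y + ereal (- a)) ` ?S"
    by (auto simp: E simp del: ereal_minus)
  then have "atom (recentre \<nu>) k = (SUP y\<in>?S. y + ereal (- a))" by (simp add: atom_def)
  \<comment> \<open>A constant moves out of a supremum only over a nonempty set; for an empty
    \<open>?S\<close> both sides are -\<infinity>.\<close>
  also have "\<dots> = Sup ?S - ereal a"
    by (cases "?S = {}") (simp_all add: SUP_ereal_add_left[where f="\<lambda>y. y"] bot_ereal_def minus_ereal_def)
  finally show ?thesis unfolding a by (simp add: atom_def)
qed

lemma max_charged_recentre: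
  assumes "sets \<nu> = sets borel" "\<forall>k\<ge>1. w k \<le> 1" "\<bar>atom \<nu> 1\<bar> \<noteq> \<infinity>"
  shows "max_charged (recentre \<nu>) w = max_charged \<nu> w - atom \<nu> 1"
proof -
  have "max_charged (recentre \<nu>) w = (SUP k\<in>{1..}. atom \<nu> k + w k + - atom \<nu> 1)"
    using assms(2) atom_recentre[OF assms(1,3)]
    by (subst max_charged_eq) (simp_all add: recentre_def minus_ereal_def ac_simps)
  also have "\<dots> = max_charged \<nu> w + - atom \<nu> 1"
    unfolding max_charged_eq[OF assms(1,2)] using assms(3) by (subst SUP_ereal_add_left) auto
  finally show ?thesis by (simp add: minus_ereal_def)
qed

section \<open>Composition of the dynamics over time intervals\<close>

lemma sets_Psi_between [simp]: "sets (Psi_between w s t \<nu>) = sets \<nu>"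
proof -
  have "sets (fold (\<lambda>r. Psi (w r)) rs \<nu>) = sets \<nu>" for rs by (induction rs arbitrary: \<nu>) auto
  then show ?thesis by (simp add: Psi_between_def)
qed

lemma Psi_between_same: "Psi_between w s s = Psi (w s)"
  by (simp add: Psi_between_def fun_eq_iff)

lemma Psi_between_step:
  assumes "s \<le> t"
  shows "Psi_between w s (t + 1) \<nu> = Psi (w (t + 1)) (Psi_between w s t \<nu>)"
  using assms by (simp add: Psi_between_def upto_rec2[of s "t + 1"])

lemma Psi_between_split:
  assumes "r \<le> s" "s \<le> t"
  shows "Psi_between w r t \<nu> = Psi_between w s t (Psi_between w r (s - 1) \<nu>)"
  using assms by (simp add: Psi_between_def upto_split1)

lemma atom_Psi_between_1_finite:
  assumes "sets \<nu> = sets borel" "\<And>t. \<forall>k\<ge>1. w t k \<le> 1" "\<bar>atom \<nu> 1\<bar> \<noteq> \<infinity>"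
  shows "\<bar>atom (Psi_between w s t \<nu>) 1\<bar> \<noteq> \<infinity>"
proof -
  have "\<bar>atom (fold (\<lambda>r. Psi (w r)) rs \<nu>) 1\<bar> \<noteq> \<infinity>" for rs
    using assms(1,3)
  proof (induction rs arbitrary: \<nu>)
    case (Cons r rs)
    have "\<bar>atom (Psi (w r) \<nu>) 1\<bar> \<noteq> \<infinity>"
      using Cons.prems assms(2) by (intro atom_Psi_1_finite)
    then show ?case using Cons.IH[of "Psi (w r) \<nu>"] Cons.prems by simp
  qed simp
  then show ?thesis by (simp add: Psi_between_def)
qed

section \<open>Coupling at a renewal time\<close>

text \<open>
  \<open>c\<close> is the position of the atom born at the renewal time, \<open>e\<close> lists the \<open>n\<close> atoms born since then
  relative to \<open>c\<close>. The bound \<open>k \<le> n\<close> includes \<open>k = 0\<close>, where \<open>atom \<nu> 0 = \<infinity>\<close>, which spares a case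
  distinction when an atom is inserted.
\<close>

definition renewal_form :: "real \<Rightarrow> ereal measure \<Rightarrow> real \<Rightarrow> (nat \<Rightarrow> ereal) \<Rightarrow> nat \<Rightarrow> bool" where
  "renewal_form l \<nu> c e n \<longleftrightarrow> sets \<nu> = sets borel \<and>
     (\<forall>k\<le>n. atom \<nu> k = ereal c + e k \<and> 0 \<le> e k) \<and> (\<forall>k>n. atom \<nu> k \<le> ereal (c - l))"

lemma max_charged_renewal_form:
  assumes "renewal_form l \<nu> c e n" "\<forall>k\<ge>1. w k \<le> 1"
    and "k\<^sub>0 \<in> {1..n}" "ereal (1 - l) \<le> w k\<^sub>0"
  shows "max_charged \<nu> w = ereal c + (SUP k\<in>{1..n}. e k + w k)"
proof -
  have F: "sets \<nu> = sets borel" "\<And>k. k \<le> n \<Longrightarrow> atom \<nu> k = ereal c + e k" "\<And>k. k \<le> n \<Longrightarrow> 0 \<le> e k"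
    "\<And>k. n < k \<Longrightarrow> atom \<nu> k \<le> ereal (c - l)"
    using assms(1) by (auto simp: renewal_form_def)
  have "(SUP k\<in>{1..n}. atom \<nu> k + w k) = (SUP k\<in>{1..}. atom \<nu> k + w k)"
  proof (rule antisym)
    show "(SUP k\<in>{1..}. atom \<nu> k + w k) \<le> (SUP k\<in>{1..n}. atom \<nu> k + w k)"
    proof (rule SUP_least)
      fix k :: nat assume k: "k \<in> {1..}"
      show "atom \<nu> k + w k \<le> (SUP k\<in>{1..n}. atom \<nu> k + w k)"
      proof (cases "k \<le> n")
        case True
        then show ?thesis using k by (intro SUP_upper) auto
      next
        case False
        then have "atom \<nu> k + w k \<le> ereal (c - l) + 1"
          using F(4)[of k] assms(2) k by (intro add_mono) auto
        also have "\<dots> = ereal c + 0 + ereal (1 - l)" by (simp add: one_ereal_def)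
        also have "\<dots> \<le> ereal c + e k\<^sub>0 + w k\<^sub>0"
          using assms(3,4) F(3)[of k\<^sub>0] by (intro add_mono) auto
        also have "\<dots> = atom \<nu> k\<^sub>0 + w k\<^sub>0" using F(2)[of k\<^sub>0] assms(3) by simp
        also have "\<dots> \<le> (SUP k\<in>{1..n}. atom \<nu> k + w k)"
          using assms(3) by (intro SUP_upper)
        finally show ?thesis .
      qed
    qed
  qed (auto intro!: SUP_subset_mono)
  moreover have "(SUP k\<in>{1..n}. atom \<nu> k + w k) = (SUP k\<in>{1..n}. ereal c + (e k + w k))"
    using F(2) by (intro SUP_cong) (auto simp: add.assoc)
  moreover have "\<dots> = ereal c + (SUP k\<in>{1..n}. e k + w k)"
    using assms(3) by (intro SUP_ereal_add_right) auto
  ultimately show ?thesis by (simp add: max_charged_eq[OF F(1) assms(2)])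
qed

text \<open>The relative height \<open>m\<close> of the new atom is nonnegative, so this atom joins
  the young ones. The updated list is computed from \<open>e\<close>, \<open>n\<close> and
  \<open>w\<close> alone, without \<open>\<nu>\<close> or \<open>c\<close>; this is the autonomy
  behind the coupling.\<close>

lemma renewal_form_Psi:
  assumes "0 \<le> l" "l < 1" "renewal_form l \<nu> c e n" "\<forall>k\<ge>1. w k \<le> 1"
    and "k\<^sub>0 \<in> {1..n}" "ereal (1 - l) \<le> w k\<^sub>0"
  defines "m \<equiv> SUP k\<in>{1..n}. e k + w k"
  shows "renewal_form l (Psi w \<nu>) c
    (\<lambda>k. if k = 0 then \<infinity> else max (if k \<le> n then e k else 0) (min (e (k - 1)) m)) (Suc n)"
    (is "renewal_form l _ c ?e _")
proof -
  have F: "sets \<nu> = sets borel" "\<And>k. k \<le> n \<Longrightarrow> atom \<nu> k = ereal c + e k" "\<And>k. k \<le> n \<Longrightarrow> 0 \<le> e k"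
    "\<And>k. n < k \<Longrightarrow> atom \<nu> k \<le> ereal (c - l)"
    using assms(3) by (auto simp: renewal_form_def)
  have M: "max_charged \<nu> w = ereal c + m"
    unfolding m_def using assms(3-6) by (rule max_charged_renewal_form)
  have "0 + ereal (1 - l) \<le> e k\<^sub>0 + w k\<^sub>0"
    using assms(5,6) F(3)[of k\<^sub>0] by (intro add_mono) auto
  also have "\<dots> \<le> m" unfolding m_def using assms(5) by (intro SUP_upper)
  finally have m: "0 \<le> m" using assms(2) by (auto intro: order_trans[rotated])
  have distrib: "ereal c + min x y = min (ereal c + x) (ereal c + y)"
    "ereal c + max x y = max (ereal c + x) (ereal c + y)" for x y
    by (auto simp: min_def max_def ereal_add_le_add_iff)
  have new: "ereal c \<le> ereal c + min (e n) m"
    using m F(3)[of n] by (simp add: ereal_le_add_self)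
  have "atom (Psi w \<nu>) k = ereal c + ?e k \<and> 0 \<le> ?e k" if "k \<le> Suc n" for k
  proof (cases k)
    case (Suc i)
    then have "i \<le> n" using that by simp
    have A: "atom (Psi w \<nu>) k = max (atom \<nu> k) (ereal c + min (e i) m)"
      using F(2)[OF \<open>i \<le> n\<close>] atom_Psi[OF F(1)] by (simp add: Suc M distrib)
    have "0 \<le> ?e k" using F(3)[of k] F(3)[OF \<open>i \<le> n\<close>] m Suc by (auto simp: le_max_iff_disj)
    moreover have "atom (Psi w \<nu>) k = ereal c + ?e k"
    proof (cases "k \<le> n")
      case True
      then show ?thesis using A F(2)[OF True] by (simp add: Suc distrib)
    next
      case False
      \<comment> \<open>At rank \<open>Suc n\<close> the competing entry is an older atom, at most
        at \<open>c - l \<le> c\<close>. It loses to the inserted value, which is at least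
        \<open>c\<close>, so the placeholder 0 in the new list may stand for it.\<close>
      then have "k = Suc n" "i = n" using that Suc by auto
      moreover have "atom \<nu> (Suc n) \<le> ereal c" using F(4)[of "Suc n"] assms(1)
        by (auto elim: order_trans)
      moreover have "0 \<le> min (e n) m" using m F(3)[of n] by simp
      ultimately show ?thesis using A new by (simp add: max_absorb2 order_trans[OF _ new])
    qed
    ultimately show ?thesis by simp
  qed simp
  \<comment> \<open>An insertion shifts ranks by at most one, and ranks \<open>k\<close> and
    \<open>k - 1\<close> both belonged to older atoms.\<close>
  moreover have "atom (Psi w \<nu>) k \<le> ereal (c - l)" if "k > Suc n" for k
  proof -
    define i where "i = k - 1"
    then have i: "k = Suc i" "n < i" using that by auto
    then show ?thesis using F(4)[of k] F(4)[of i] atom_Psi[OF F(1), of w i] i by (auto intro: min.coboundedI1)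
  qed
  ultimately show ?thesis using F(1) by (simp add: renewal_form_def)
qed

text \<open>The charge \<open>w 1 \<ge> l\<close> on the top atom \<open>a\<close> forces the new
  atom \<open>c\<close> to satisfy \<open>c \<ge> a + l\<close>, so every older atom is at most at
  \<open>c - l\<close>. The list of young atoms then has the single entry 0.\<close>

lemma renewal_form_start:
  assumes "0 \<le> l" "sets \<nu> = sets borel" "\<bar>atom \<nu> 1\<bar> \<noteq> \<infinity>"
    and "\<forall>k\<ge>1. w k \<le> 1" "ereal l \<le> w 1"
  shows "\<exists>c. renewal_form l (Psi w \<nu>) c (\<lambda>k. if k = 0 then \<infinity> else 0) 1"
proof -
  obtain a where a: "atom \<nu> 1 = ereal a" using assms(3) by auto
  \<comment> \<open>The upper bound serves only to make the new position a real number; the lower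
    bound gives the gap \<open>l\<close>.\<close>
  have "max_charged \<nu> w \<le> ereal (a + 1)" using max_charged_le[OF assms(2,4)] a by simp
  moreover have "ereal (a + l) \<le> max_charged \<nu> w"
    using max_charged_ge[OF assms(2,4), of 1] add_left_mono[OF assms(5), of "ereal a"] a by auto
  ultimately obtain c where c: "max_charged \<nu> w = ereal c" "a + l \<le> c"
    by (cases "max_charged \<nu> w") auto
  have "atom (Psi w \<nu>) 1 = ereal c"
    using atom_Psi[OF assms(2), of w 0] a c assms(1) by (simp add: max_def)
  moreover have "atom (Psi w \<nu>) k \<le> ereal (c - l)" if "k > 1" for k
  proof -
    define i where "i = k - 1"
    then have i: "k = Suc i" "1 \<le> i" using that by auto
    then have "atom \<nu> k \<le> ereal a" "atom \<nu> i \<le> ereal a"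
      using atom_antimono[of 1 k \<nu>] atom_antimono[of 1 i \<nu>] a by auto
    then have "atom (Psi w \<nu>) k \<le> ereal a"
      using atom_Psi[OF assms(2), of w i] i by (auto intro: min.coboundedI1)
    also have "\<dots> \<le> ereal (c - l)" using c(2) by simp
    finally show ?thesis .
  qed
  ultimately show ?thesis
    using assms(2) by (intro exI[of _ c]) (auto simp: renewal_form_def le_Suc_eq)
qed

lemma wbar_ge_iff:
  assumes "1 \<le> j"
  shows "x \<le> wbar w T j \<longleftrightarrow> (\<exists>i\<in>{1..j}. x \<le> w (T + int j) i)"
  using assms by (simp add: wbar_def Max_ge_iff)

text \<open>The order of quantifiers is the point: one list \<open>e\<close> serves all initial
  measures, and only the position \<open>c\<close> depends on \<open>\<nu>\<close>.\<close>

lemma renewal_form_Psi_between: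
  assumes l: "0 \<le> l" "l < 1" and w: "\<And>t. \<forall>k\<ge>1. w t k \<le> 1"
    and T: "ereal l \<le> w T 1" "\<And>j. 1 \<le> j \<Longrightarrow> j \<le> n \<Longrightarrow> ereal (1 - l) \<le> wbar w T j"
  shows "\<exists>e. \<forall>\<nu>. sets \<nu> = sets borel \<longrightarrow> \<bar>atom \<nu> 1\<bar> \<noteq> \<infinity> \<longrightarrow>
    (\<exists>c. renewal_form l (Psi_between w T (T + int n) \<nu>) c e (Suc n))"
  using T(2)
proof (induction n)
  case 0
  then show ?case
    using renewal_form_start[OF l(1) _ _ w T(1)]
    by (intro exI[of _ "\<lambda>k. if k = 0 then \<infinity> else 0"]) (simp add: Psi_between_same)
next
  case (Suc n)
  then obtain e where e: "\<And>\<nu>. sets \<nu> = sets borel \<Longrightarrow> \<bar>atom \<nu> 1\<bar> \<noteq> \<infinity> \<Longrightarrow>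
    \<exists>c. renewal_form l (Psi_between w T (T + int n) \<nu>) c e (Suc n)" by auto
  \<comment> \<open>Just before time \<open>T + Suc n\<close> there are \<open>Suc n\<close> young
    atoms, and \<open>wbar w T (Suc n)\<close> is the maximum of exactly their charges. Hence the
    charge attaining it acts on a young atom.\<close>
  obtain k\<^sub>0 where k0: "k\<^sub>0 \<in> {1..Suc n}" "ereal (1 - l) \<le> w (T + int (Suc n)) k\<^sub>0"
    using Suc.prems[of "Suc n"] by (auto simp: wbar_ge_iff)
  have step: "Psi_between w T (T + int (Suc n)) \<nu> =
      Psi (w (T + int (Suc n))) (Psi_between w T (T + int n) \<nu>)" for \<nu>
    using Psi_between_step[of T "T + int n" w \<nu>] by (simp add: add.assoc add.commute[of 1])
  note form = renewal_form_Psi[OF l _ w k0, of _ _ e]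
  have "\<exists>c. renewal_form l (Psi_between w T (T + int (Suc n)) \<nu>) c (\<lambda>k. if k = 0 then \<infinity> else
      max (if k \<le> Suc n then e k else 0)
        (min (e (k - 1)) (SUP k\<in>{1..Suc n}. e k + w (T + int (Suc n)) k))) (Suc (Suc n))"
    if \<nu>: "sets \<nu> = sets borel" "\<bar>atom \<nu> 1\<bar> \<noteq> \<infinity>" for \<nu>
  proof -
    obtain c where "renewal_form l (Psi_between w T (T + int n) \<nu>) c e (Suc n)"
      using e[OF \<nu>] ..
    from form[OF this] show ?thesis unfolding step by (rule exI)
  qed
  then show ?case by blast
qed

text \<open>The charged maximum and the top atom both have the form \<open>c\<close> plus a quantity
  determined by \<open>e\<close> and the charges. Recentring subtracts one from the other and
  cancels \<open>c\<close>, the only trace of the initial measure.\<close>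

lemma max_charged_recentre_coupling:
  assumes l: "0 \<le> l" "l < 1" and w: "\<And>t. \<forall>k\<ge>1. w t k \<le> 1"
    and T: "ereal l \<le> w T 1" "\<And>j. 1 \<le> j \<Longrightarrow> j \<le> Suc n \<Longrightarrow> ereal (1 - l) \<le> wbar w T j"
    and \<nu>: "sets \<nu> = sets borel" "\<bar>atom \<nu> 1\<bar> \<noteq> \<infinity>"
    and \<mu>: "sets \<mu> = sets borel" "\<bar>atom \<mu> 1\<bar> \<noteq> \<infinity>"
  shows "max_charged (recentre (Psi_between w T (T + int n) \<nu>)) (w (T + int (Suc n)))
       = max_charged (recentre (Psi_between w T (T + int n) \<mu>)) (w (T + int (Suc n)))"
proof -
  let ?P = "Psi_between w T (T + int n)" and ?w = "w (T + int (Suc n))"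
  obtain e where e: "\<And>\<nu>. sets \<nu> = sets borel \<Longrightarrow> \<bar>atom \<nu> 1\<bar> \<noteq> \<infinity> \<Longrightarrow>
      \<exists>c. renewal_form l (?P \<nu>) c e (Suc n)"
    using renewal_form_Psi_between[where w=w and n=n, OF l w T(1)] T(2) by (metis le_SucI)
  obtain k\<^sub>0 where k0: "k\<^sub>0 \<in> {1..Suc n}" "ereal (1 - l) \<le> ?w k\<^sub>0"
    using T(2)[of "Suc n"] by (auto simp: wbar_ge_iff)
  have "max_charged (recentre (?P \<nu>)) ?w = (SUP k\<in>{1..Suc n}. e k + ?w k) - e 1"
    if \<nu>: "sets \<nu> = sets borel" "\<bar>atom \<nu> 1\<bar> \<noteq> \<infinity>" for \<nu>
  proof -
    \<comment> \<open>Cancellation needs \<open>b\<close> and \<open>c\<close> real, whence the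
      separate argument that the top atom is finite.\<close>
    have cancel: "(ereal c + x) - (ereal c + ereal b) = x - ereal b" for x and b c :: real
      by (cases x) auto
    obtain c where c: "renewal_form l (?P \<nu>) c e (Suc n)" using e[OF \<nu>] ..
    have fin: "\<bar>atom (?P \<nu>) 1\<bar> \<noteq> \<infinity>" using \<nu> w by (intro atom_Psi_between_1_finite)
    have A: "atom (?P \<nu>) 1 = ereal c + e 1" using c by (simp add: renewal_form_def)
    then obtain b where b: "e 1 = ereal b" using fin by (cases "e 1") auto
    have "max_charged (recentre (?P \<nu>)) ?w = max_charged (?P \<nu>) ?w - atom (?P \<nu>) 1"
      using \<nu>(1) w fin by (intro max_charged_recentre) simp_all
    also have "\<dots> = (ereal c + (SUP k\<in>{1..Suc n}. e k + ?w k)) - (ereal c + e 1)"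
      unfolding A using max_charged_renewal_form[OF c w k0] by simp
    also have "\<dots> = (SUP k\<in>{1..Suc n}. e k + ?w k) - e 1"
      unfolding b using cancel .
    finally show ?thesis .
  qed
  then show ?thesis using \<nu> \<mu> by simp
qed

section \<open>Enumeration of the renewal set\<close>

text \<open>Each value of \<open>T\<close> is some \<open>T' j\<close>, and the comparison follows
  by locating \<open>j\<close>: no element of \<open>range T'\<close> lies strictly between
  neighbouring values of \<open>T'\<close>. Exchanging the two enumerations gives the reverse
  inequalities.\<close>

lemma strict_mono_int_enum_le:
  fixes T T' :: "int \<Rightarrow> int"
  assumes "strict_mono T" "strict_mono T'" "range T \<subseteq> range T'"
  shows "T i = T' i \<Longrightarrow> T' (i + 1) \<le> T (i + 1)" "T i = T' i \<Longrightarrow> T (i - 1) \<le> T' (i - 1)"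
    and "T 0 \<le> 0 \<Longrightarrow> 0 < T' 1 \<Longrightarrow> T 0 \<le> T' 0"
proof -
  have *: "\<exists>j. T i = T' j" for i using assms(3) by auto
  note mono = strict_mono_less_eq[OF assms(2)] strict_mono_less[OF assms(2)] strict_mono_less[OF assms(1)]
  show "T' (i + 1) \<le> T (i + 1)" if "T i = T' i"
  proof -
    obtain j where j: "T (i + 1) = T' j" using * by blast
    then have "T' i < T' j" using that mono(3)[of i "i + 1"] by simp
    then show ?thesis using j by (simp add: mono)
  qed
  show "T (i - 1) \<le> T' (i - 1)" if "T i = T' i"
  proof -
    obtain j where j: "T (i - 1) = T' j" using * by blast
    then have "T' j < T' i" using that mono(3)[of "i - 1" i] by simp
    then show ?thesis using j by (simp add: mono)
  qed
  show "T 0 \<le> T' 0" if "T 0 \<le> 0" "0 < T' 1"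
  proof -
    obtain j where j: "T 0 = T' j" using * by blast
    then have "T' j < T' 1" using that by simp
    then show ?thesis using j by (simp add: mono)
  qed
qed

lemma strict_mono_int_enum_unique:
  fixes T T' :: "int \<Rightarrow> int"
  assumes "strict_mono T" "strict_mono T'" "range T = range T'"
    and "T 0 \<le> 0" "0 < T 1" "T' 0 \<le> 0" "0 < T' 1"
  shows "T = T'"
proof
  note le = strict_mono_int_enum_le[OF assms(1,2)] strict_mono_int_enum_le[OF assms(2,1)]
  show "T i = T' i" for i
  proof (induction i rule: int_induct[of _ 0])
    case base
    then show ?case using le(3,6) assms by (intro antisym) auto
  next
    case (step1 i)
    then show ?case using le(1,4)[of i] assms by (intro antisym) auto
  next
    case (step2 i)
    then show ?case using le(2,5)[of i] assms by (intro antisym) auto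
  qed
qed

lemma strict_mono_int_enum_exists:
  fixes S :: "int set"
  assumes "\<And>n. \<exists>k\<in>S. k < n" "\<And>n. \<exists>k\<in>S. n < k"
  shows "\<exists>T::int \<Rightarrow> int. strict_mono T \<and> range T = S \<and> T 0 \<le> 0 \<and> 0 < T 1"
proof -
  define A where "A = {n::nat. 0 < n \<and> int n \<in> S}"
  define B where "B = {n::nat. - int n \<in> S}"
  have "\<exists>n>m. n \<in> A" for m
  proof -
    obtain k where "k \<in> S" "int m < k" using assms(2) by blast
    then show ?thesis by (intro exI[of _ "nat k"]) (auto simp: A_def)
  qed
  then have A: "infinite A" by (simp add: infinite_nat_iff_unbounded)
  have "\<exists>n>m. n \<in> B" for m
  proof -
    obtain k where "k \<in> S" "k < - int m" using assms(1) by blast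
    then show ?thesis by (intro exI[of _ "nat (- k)"]) (auto simp: B_def)
  qed
  then have B: "infinite B" by (simp add: infinite_nat_iff_unbounded)
  \<comment> \<open>Positive times are enumerated upwards from index 1, and the negatives of
    nonpositive times from index 0 downwards. Both copies of \<open>enumerate\<close> start at 0, so
    the normalisation \<open>T 0 \<le> 0 < T 1\<close> is built in.\<close>
  define T where "T i = (if 0 < i then int (enumerate A (nat (i - 1))) else - int (enumerate B (nat (- i))))"
    for i :: int
  have mem: "enumerate A n \<in> A" "enumerate B n \<in> B" for n
    using A B by (auto intro: enumerate_in_set)
  then have pos: "0 < enumerate A n" for n by (auto simp: A_def)
  have "strict_mono T"
  proof (rule strict_monoI)
    fix i j :: int assume ij: "i < j"
    consider "0 < i" | "i \<le> 0" "0 < j" | "j \<le> 0" by linarith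
    then show "T i < T j"
    proof cases
      case 1
      then show ?thesis using ij A by (auto simp: T_def intro!: enumerate_mono)
    next
      case 2
      then show ?thesis using pos[of "nat (j - 1)"] by (simp add: T_def)
    next
      case 3
      then show ?thesis using ij B by (auto simp: T_def intro!: enumerate_mono)
    qed
  qed
  moreover have "range T = S"
  proof
    show "range T \<subseteq> S" using mem by (auto simp: T_def A_def B_def)
    show "S \<subseteq> range T"
    proof
      fix k assume k: "k \<in> S"
      show "k \<in> range T"
      proof (cases "0 < k")
        case True
        then have "nat k \<in> A" using k by (simp add: A_def)
        then obtain n where "enumerate A n = nat k" using range_enumerate[OF A] by (metis imageE)
        then have "T (int n + 1) = k" using True by (simp add: T_def)
        then show ?thesis by (rule range_eqI[OF sym])
      next
        case False
        then have "nat (- k) \<in> B" using k by (simp add: B_def)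
        then obtain n where "enumerate B n = nat (- k)" using range_enumerate[OF B] by (metis imageE)
        then have "T (- int n) = k" using False by (simp add: T_def)
        then show ?thesis by (rule range_eqI[OF sym])
      qed
    qed
  qed
  moreover have "T 0 \<le> 0" "0 < T 1" using pos[of 0] by (auto simp: T_def)
  ultimately show ?thesis by blast
qed

text \<open>The index is the largest \<open>i\<close> in \<open>{a..b}\<close> with
  \<open>T i < t\<close>. Two such indices satisfy \<open>T i < T (j + 1)\<close> and
  \<open>T j < T (i + 1)\<close>, which leaves only \<open>i = j\<close>.\<close>

lemma strict_mono_int_bracket:
  fixes T :: "int \<Rightarrow> int"
  assumes "strict_mono T" "T a < t" "t \<le> T b"
  shows "\<exists>!i. T i < t \<and> t \<le> T (i + 1)"
proof (rule ex_ex1I)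
  let ?I = "{i\<in>{a..b}. T i < t}"
  have "a < b" using assms(2,3) strict_mono_less[OF assms(1), of a b] by linarith
  then have "a \<in> ?I" using assms(2) by simp
  then have I: "finite ?I" "?I \<noteq> {}" by (auto intro: finite_subset[of _ "{a..b}"])
  then have M: "Max ?I \<in> ?I" by (rule Max_in)
  then have "Max ?I \<noteq> b" using assms(3) by auto
  then have "Max ?I + 1 \<in> {a..b}" using M by auto
  then have "t \<le> T (Max ?I + 1)" using Max_ge[OF I(1), of "Max ?I + 1"] by (auto simp: not_le[symmetric])
  then show "\<exists>i. T i < t \<and> t \<le> T (i + 1)" using M by blast
next
  fix i j assume "T i < t \<and> t \<le> T (i + 1)" "T j < t \<and> t \<le> T (j + 1)"
  then have "T i < T (j + 1)" "T j < T (i + 1)" by auto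
  then show "i = j" by (simp add: strict_mono_less[OF assms(1)])
qed

text \<open>Unboundedness in both directions makes the two definite descriptions meaningful.
  Afterwards only these two properties of the last renewal time are needed.\<close>

lemma last_renewal_time:
  assumes "\<And>n. \<exists>k\<in>renewal_set w l. k < n" "\<And>n. \<exists>k\<in>renewal_set w l. n < k"
  shows "renewal_time w l (renewal_index w l t) \<in> renewal_set w l"
    and "renewal_time w l (renewal_index w l t) < t"
proof -
  let ?T = "renewal_time w l" and ?S = "renewal_set w l"
  let ?P = "\<lambda>T::int \<Rightarrow> int. strict_mono T \<and> range T = ?S \<and> T 0 \<le> 0 \<and> 0 < T 1"
  have "\<exists>!T. ?P T"
  proof (rule ex_ex1I)
    show "\<exists>T. ?P T" by (rule strict_mono_int_enum_exists[OF assms])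
    show "T = T'" if "?P T" "?P T'" for T T'
      using that by (intro strict_mono_int_enum_unique) auto
  qed
  then have T: "?P ?T" unfolding renewal_time_def by (rule theI')
  then show "?T (renewal_index w l t) \<in> ?S" by blast
  obtain x y where "x \<in> ?S" "x < t" "y \<in> ?S" "t < y" using assms(1)[of t] assms(2)[of t] by blast
  moreover from this T obtain a b where "?T a = x" "?T b = y" by (metis imageE)
  ultimately have "?T a < t" "t \<le> ?T b" by auto
  then have "\<exists>!i. ?T i < t \<and> t \<le> ?T (i + 1)" using T by (intro strict_mono_int_bracket) auto
  from theI'[OF this] show "?T (renewal_index w l t) < t" unfolding renewal_index_def by (rule conjunct1)
qed

section \<open>The supremum defining \<open>T_star\<close> as an attained maximum\<close>

lemma Sup_int_attained:
  fixes D :: "int set"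
  assumes "t\<^sub>0 \<in> D" "\<And>t. t \<in> D \<Longrightarrow> t \<le> b"
  shows "\<exists>m\<in>D. (\<forall>t\<in>D. t \<le> m) \<and> (SUP t\<in>D. ereal (of_int t)) = ereal (of_int m)"
proof -
  let ?A = "D \<inter> {t\<^sub>0..b}"
  have A: "finite ?A" "?A \<noteq> {}" using assms by auto
  define m where "m = Max ?A"
  have m: "m \<in> ?A" unfolding m_def using A by (rule Max_in)
  have le: "t \<le> m" if "t \<in> D" for t
  proof (cases "t\<^sub>0 \<le> t")
    case True
    then show ?thesis unfolding m_def using A that assms(2) by (intro Max_ge) auto
  qed (use m in auto)
  have "(SUP t\<in>D. ereal (of_int t)) = ereal (of_int m)"
    using m le by (intro antisym SUP_least SUP_upper) auto
  then show ?thesis using m le by blast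
qed

text \<open>A renewal at \<open>t\<^sub>0\<close> satisfies the bounds at all lags, in particular
  those up to \<open>nat \<bar>t\<^sub>0\<bar>\<close>. It is therefore a candidate in the set
  defining \<open>T_star\<close>, which makes that set nonempty and bounds its maximum from
  below.\<close>

lemma T_star_attained:
  assumes "renewal w l t\<^sub>0" "t\<^sub>0 \<le> -1"
  obtains t where "t\<^sub>0 \<le> t" "t \<le> -1" "T_star w l = ereal (of_int t)" "ereal l \<le> w t 1"
    and "\<And>j. 1 \<le> j \<Longrightarrow> j \<le> nat \<bar>t\<bar> \<Longrightarrow> ereal (1 - l) \<le> wbar w t j"
proof -
  let ?D = "{t::int. t \<le> -1 \<and> w t 1 \<ge> ereal l \<and> (MIN j\<in>{1..nat \<bar>t\<bar>}. wbar w t j) \<ge> ereal (1 - l)}"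
  have Min: "(MIN j\<in>{1..nat \<bar>t\<bar>}. wbar w t j) \<ge> ereal (1 - l) \<longleftrightarrow>
      (\<forall>j\<in>{1..nat \<bar>t\<bar>}. wbar w t j \<ge> ereal (1 - l))" if "t \<le> -1" for t
    using that by (subst Min_ge_iff) auto
  have "t\<^sub>0 \<in> ?D" using assms Min[of t\<^sub>0] by (auto simp: renewal_def)
  then have "\<exists>m\<in>?D. (\<forall>t\<in>?D. t \<le> m) \<and> (SUP t\<in>?D. ereal (of_int t)) = ereal (of_int m)"
    by (rule Sup_int_attained) blast
  then obtain t where t: "t \<in> ?D" "\<forall>s\<in>?D. s \<le> t" "(SUP t\<in>?D. ereal (of_int t)) = ereal (of_int t)"
    by blast
  show thesis
  proof (rule that)
    show "t\<^sub>0 \<le> t" using t(2) \<open>t\<^sub>0 \<in> ?D\<close> by blast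
    show "T_star w l = ereal (of_int t)" using t(3) by (simp add: T_star_def)
    show "ereal (1 - l) \<le> wbar w t j" if "1 \<le> j" "j \<le> nat \<bar>t\<bar>" for j
      using t(1) Min[of t] that by auto
  qed (use t in auto)
qed

section \<open>Renewals occur infinitely often\<close>

text \<open>The geometric series converges, so the infinite product has a nonzero limit. All factors
  are at most 1, so the partial products decrease to this limit, which serves as
  \<open>c\<close>.\<close>

lemma prod_one_minus_power_bounded_below:
  fixes q :: real
  assumes "0 \<le> q" "q < 1"
  obtains c where "0 < c" "\<And>n. c \<le> (\<Prod>i<n. 1 - q ^ Suc i)"
proof -
  let ?f = "\<lambda>i. 1 - q ^ Suc i"
  have f: "0 < ?f i" "?f i \<le> 1" for i
    using assms by (simp_all add: power_less_one_iff mult_le_one power_le_one del: power_Suc)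
  have "summable (\<lambda>i. q * q ^ i)" using assms by (intro summable_mult summable_geometric) auto
  then have "abs_convergent_prod ?f" by (simp add: abs_convergent_prod_conv_summable assms(1))
  then have "convergent_prod ?f" by (rule abs_convergent_prod_imp_convergent_prod)
  then obtain L where L: "(\<lambda>n. \<Prod>i\<le>n. ?f i) \<longlonglongrightarrow> L" "L \<noteq> 0"
    using f(1) by (subst (asm) convergent_prod_iff_nz_lim) (auto simp: less_le)
  have dec: "decseq (\<lambda>n. \<Prod>i\<le>n. ?f i)"
    unfolding decseq_Suc_iff prod.atMost_Suc using f(1)[THEN less_imp_le] f(2)
    by (intro allI mult_left_le prod_nonneg)
  have "0 \<le> L" using f(1)[THEN less_imp_le]
    by (intro LIMSEQ_le_const[OF L(1)] exI allI impI prod_nonneg)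
  moreover have "L \<le> (\<Prod>i<n. ?f i)" for n
  proof -
    have "L \<le> (\<Prod>i\<le>n. ?f i)" using dec L(1) by (rule decseq_ge)
    also have "\<dots> \<le> (\<Prod>i<n. ?f i)"
      unfolding lessThan_Suc_atMost[symmetric] prod.lessThan_Suc
      using f(1)[THEN less_imp_le] f(2) by (intro mult_left_le prod_nonneg)
    finally show ?thesis .
  qed
  ultimately show thesis using L(2) by (intro that[of L]) auto
qed

context prob_space
begin

text \<open>Events read off disjoint blocks of independent variables are independent.
  \<open>P j\<close> expresses the event on the product space of block \<open>j\<close>, where its
  measurability is checked; \<open>Q j\<close> is the same event on the sample space.\<close>

lemma indep_events_blocks:
  assumes "indep_vars N X I" "\<And>j. j \<in> L \<Longrightarrow> K j \<subseteq> I" "disjoint_family_on K L"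
    and "\<And>j. j \<in> L \<Longrightarrow> Measurable.pred (PiM (K j) N) (P j)"
    and "\<And>j \<omega>. j \<in> L \<Longrightarrow> \<omega> \<in> space M \<Longrightarrow> P j (restrict (\<lambda>i. X i \<omega>) (K j)) \<longleftrightarrow> Q j \<omega>"
  shows "indep_events (\<lambda>j. {\<omega>\<in>space M. Q j \<omega>}) L"
proof -
  have "indep_events (\<lambda>j. {\<omega>\<in>space M. P j (restrict (\<lambda>i. X i \<omega>) (K j))}) L"
    using assms(4) by (intro indep_eventsI_indep_vars[OF indep_vars_restrict[OF assms(1-3)]])
      (auto simp: pred_def)
  moreover have "{\<omega>\<in>space M. P j (restrict (\<lambda>i. X i \<omega>) (K j))} = {\<omega>\<in>space M. Q j \<omega>}" if "j \<in> L" for j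
    using assms(5)[OF that] by auto
  ultimately show ?thesis
    unfolding indep_events_def_alt by (subst (asm) indep_sets_cong[OF refl]) auto
qed

text \<open>By continuity from above the limit superior of the events has probability at least
  \<open>c > 0\<close>, and the zero-one law raises this to 1.\<close>

lemma AE_infinitely_often_indep_events:
  assumes "indep_events (\<lambda>n. {\<omega>\<in>space M. P n \<omega>}) (UNIV :: nat set)"
    and "0 < c" "\<And>n. c \<le> prob {\<omega>\<in>space M. P n \<omega>}"
  shows "AE \<omega> in M. infinite {n. P n \<omega>}"
proof -
  let ?P = "\<lambda>n. {\<omega>\<in>space M. P n \<omega>}"
  define A where "A n = (\<Union>m\<in>{n..}. ?P m)" for n :: nat
  have P: "?P n \<in> events" for n using assms(1) by (auto simp: indep_events_def)
  then have A: "A n \<in> events" for n by (auto simp: A_def)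
  have "decseq A" unfolding A_def decseq_def by (intro allI impI UN_mono) auto
  then have "(\<lambda>n. prob (A n)) \<longlonglongrightarrow> prob (\<Inter>n. A n)"
    using A by (intro finite_Lim_measure_decseq) auto
  moreover have "c \<le> prob (A n)" for n
    using assms(3)[of n] A P by (intro order_trans[OF assms(3)[of n]] finite_measure_mono) (auto simp: A_def)
  ultimately have "c \<le> prob (\<Inter>n. A n)" by (intro LIMSEQ_le_const) auto
  moreover have "prob (\<Inter>n. A n) = 0 \<or> prob (\<Inter>n. A n) = 1"
    unfolding A_def using assms(1) by (rule borel_0_1_law)
  ultimately have "prob (\<Inter>n. A n) = 1" using assms(2) by auto
  then have "AE \<omega> in M. \<omega> \<in> (\<Inter>n. A n)" using A by (subst (asm) prob_eq_1) auto
  then show ?thesis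
  proof eventually_elim
    case (elim \<omega>)
    then have "\<forall>m. \<exists>n\<ge>m. n \<in> {n. P n \<omega>}" by (auto simp: A_def)
    then show ?case by (simp add: infinite_nat_iff_unbounded_le)
  qed
qed

lemma prob_all_below:
  fixes w :: "int \<Rightarrow> nat \<Rightarrow> 'a \<Rightarrow> ereal"
  assumes indep: "indep_vars (\<lambda>_. borel) (\<lambda>(t, j). w t j) (UNIV \<times> {1..})"
    and q: "\<And>t. \<forall>j\<ge>1. prob {\<omega>\<in>space M. w t j \<omega> < a} = q"
  shows "prob {\<omega>\<in>space M. \<forall>i\<in>{1..j}. w t i \<omega> < a} = q ^ j"
proof (cases "j = 0")
  case True
  then show ?thesis by (simp add: prob_space)
next
  case False
  have "prob (\<Inter>x\<in>{t} \<times> {1..j}. (case x of (t, j) \<Rightarrow> w t j) -` {..<a} \<inter> space M)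
      = (\<Prod>x\<in>{t} \<times> {1..j}. prob ((case x of (t, j) \<Rightarrow> w t j) -` {..<a} \<inter> space M))"
    using False by (intro indep_varsD[OF indep]) auto
  moreover have "(\<Inter>x\<in>{t} \<times> {1..j}. (case x of (t, j) \<Rightarrow> w t j) -` {..<a} \<inter> space M)
      = {\<omega>\<in>space M. \<forall>i\<in>{1..j}. w t i \<omega> < a}"
    using False by auto
  moreover have "prob ((case x of (t, j) \<Rightarrow> w t j) -` {..<a} \<inter> space M) = q" if "x \<in> {t} \<times> {1..j}" for x
    using that q by (auto simp: vimage_def Int_def conj_commute)
  ultimately show ?thesis by simp
qed

text \<open>The condition at lag \<open>j\<close> only involves the charges at time
  \<open>k + j\<close>, so the conditions are independent over lags. At lag \<open>j \<ge> 1\<close>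
  all \<open>j\<close> charges fall below \<open>a\<close> with probability
  \<open>q ^ j\<close>.\<close>

lemma prob_renewal_until:
  fixes w :: "int \<Rightarrow> nat \<Rightarrow> 'a \<Rightarrow> ereal" and a b :: ereal
  assumes indep: "indep_vars (\<lambda>_. borel) (\<lambda>(t, j). w t j) (UNIV \<times> {1..})"
    and p: "\<And>t. prob {\<omega>\<in>space M. b \<le> w t 1 \<omega>} = p"
    and q: "\<And>t. \<forall>j\<ge>1. prob {\<omega>\<in>space M. w t j \<omega> < a} = q"
  shows "prob {\<omega>\<in>space M. b \<le> w k 1 \<omega> \<and> (\<forall>j\<in>{1..n}. \<exists>i\<in>{1..j}. a \<le> w (k + int j) i \<omega>)}
    = p * (\<Prod>i<n. 1 - q ^ Suc i)"
proof -
  have [measurable]: "w t j \<in> borel_measurable M" if "1 \<le> j" for t j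
    using indep that by (force simp: indep_vars_def)
  define Q where "Q j \<omega> \<longleftrightarrow> (if j = 0 then b \<le> w k 1 \<omega> else \<exists>i\<in>{1..j}. a \<le> w (k + int j) i \<omega>)"
    for j \<omega>
  define P where "P j x \<longleftrightarrow> (if j = 0 then b \<le> x (k, 1) else \<exists>i\<in>{1..j}. a \<le> x (k + int j, i))"
    for j :: nat and x :: "int \<times> nat \<Rightarrow> ereal"
  define K where "K j = {k + int j} \<times> {1::nat..}" for j :: nat
  have pQ: "prob {\<omega>\<in>space M. Q (Suc i) \<omega>} = 1 - q ^ Suc i" for i
  proof -
    have "{\<omega>\<in>space M. \<forall>j\<in>{1..Suc i}. w (k + int (Suc i)) j \<omega> < a} \<in> events"
      by measurable
    then have "1 - q ^ Suc i = prob (space M - {\<omega>\<in>space M. \<forall>j\<in>{1..Suc i}. w (k + int (Suc i)) j \<omega> < a})"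
      using prob_all_below[OF indep q, of "Suc i" "k + int (Suc i)"] by (subst prob_compl) auto
    also have "\<dots> = prob {\<omega>\<in>space M. Q (Suc i) \<omega>}"
      by (intro arg_cong[where f=prob]) (auto simp: Q_def not_less)
    finally show ?thesis ..
  qed
  have "indep_events (\<lambda>j. {\<omega>\<in>space M. Q j \<omega>}) {..n}"
  proof (rule indep_events_blocks[OF indep])
    show "disjoint_family_on K {..n}" by (auto simp: disjoint_family_on_def K_def)
    show "Measurable.pred (PiM (K j) (\<lambda>_. borel)) (P j)" for j
    proof -
      have comp [measurable]: "(\<lambda>x. x (k + int j, i)) \<in> borel_measurable (PiM (K j) (\<lambda>_. borel :: ereal measure))"
        if "1 \<le> i" for i
        using that by (intro measurable_component_singleton) (auto simp: K_def)
      show ?thesis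
      proof (cases "j = 0")
        case True
        then show ?thesis using comp[of 1] unfolding P_def by simp
      next
        case False
        then show ?thesis unfolding P_def by (auto intro!: pred_intros_finite)
      qed
    qed
  qed (auto simp: K_def P_def Q_def)
  then have "prob (\<Inter>j\<in>{..n}. {\<omega>\<in>space M. Q j \<omega>}) = (\<Prod>j\<le>n. prob {\<omega>\<in>space M. Q j \<omega>})"
    by (auto simp: indep_events_def)
  also have "\<dots> = prob {\<omega>\<in>space M. Q 0 \<omega>} * (\<Prod>i<n. prob {\<omega>\<in>space M. Q (Suc i) \<omega>})"
    by (rule prod.atMost_shift)
  also have "\<dots> = p * (\<Prod>i<n. 1 - q ^ Suc i)" unfolding pQ using p by (simp add: Q_def)
  also have "(\<Inter>j\<in>{..n}. {\<omega>\<in>space M. Q j \<omega>}) = (\<Inter>j\<in>insert 0 {1..n}. {\<omega>\<in>space M. Q j \<omega>})"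
    by (rule arg_cong[where f="\<lambda>J. \<Inter>j\<in>J. {\<omega>\<in>space M. Q j \<omega>}"]) auto
  also have "\<dots> = {\<omega>\<in>space M. b \<le> w k 1 \<omega> \<and> (\<forall>j\<in>{1..n}. \<exists>i\<in>{1..j}. a \<le> w (k + int j) i \<omega>)}"
    by (auto simp: Q_def)
  finally show ?thesis .
qed

lemma AE_infinitely_many_renewals:
  fixes w :: "int \<Rightarrow> nat \<Rightarrow> 'a \<Rightarrow> ereal" and k :: "nat \<Rightarrow> int"
  assumes indep: "indep_vars (\<lambda>_. borel) (\<lambda>(t, j). w t j) (UNIV \<times> {1..})"
    and p: "0 < p" "\<And>t. prob {\<omega>\<in>space M. ereal l \<le> w t 1 \<omega>} = p"
    and q: "q < 1" "\<And>t. \<forall>j\<ge>1. prob {\<omega>\<in>space M. w t j \<omega> < ereal (1 - l)} = q"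
    and k: "disjoint_family (\<lambda>n. {k n..k n + int n})"
  shows "AE \<omega> in M. infinite {n. renewal (\<lambda>t j. w t j \<omega>) l (k n)}"
proof -
  have [measurable]: "w t j \<in> borel_measurable M" if "1 \<le> j" for t j
    using indep that by (force simp: indep_vars_def)
  have q0: "0 \<le> q" using q(2)[of 0, THEN spec, of 1] by auto
  have geom: "summable (\<lambda>i. q ^ (n + i))" for n
    using q0 q(1) by (simp add: power_add summable_mult summable_geometric)
  define Q where "Q n \<omega> \<longleftrightarrow> ereal l \<le> w (k n) 1 \<omega> \<and>
    (\<forall>j\<in>{1..n}. \<exists>i\<in>{1..j}. ereal (1 - l) \<le> w (k n + int j) i \<omega>)" for n \<omega>
  \<comment> \<open>\<open>B n j\<close> is the failure at lag \<open>n + j\<close> of the candidate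
    \<open>k n\<close>; the union over \<open>j\<close> contains every failure beyond the horizon
    \<open>n\<close>.\<close>
  define B where "B n j = {\<omega>\<in>space M. \<forall>i\<in>{1..n + j}. w (k n + int (n + j)) i \<omega> < ereal (1 - l)}"
    for n j
  have B: "B n j \<in> events" for n j unfolding B_def by measurable
  obtain c where c: "0 < c" "\<And>n. c \<le> (\<Prod>i<n. 1 - q ^ Suc i)"
    using prod_one_minus_power_bounded_below[OF q0 q(1)] by blast
  have "AE \<omega> in M. infinite {n. Q n \<omega>}"
  proof (rule AE_infinitely_often_indep_events)
    define K where "K n = {k n..k n + int n} \<times> {1::nat..}" for n
    define P where "P n x \<longleftrightarrow> ereal l \<le> x (k n, 1) \<and>
      (\<forall>j\<in>{1..n}. \<exists>i\<in>{1..j}. ereal (1 - l) \<le> x (k n + int j, i))" for n and x :: "int \<times> nat \<Rightarrow> ereal"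
    show "indep_events (\<lambda>n. {\<omega>\<in>space M. Q n \<omega>}) UNIV"
    proof (rule indep_events_blocks[OF indep])
      show "disjoint_family K"
        using k unfolding disjoint_family_on_def K_def Times_Int_Times by (metis Sigma_empty1)
      show "Measurable.pred (PiM (K n) (\<lambda>_. borel)) (P n)" for n
      proof -
        have [measurable]: "(\<lambda>x. x (k n + int j, i)) \<in> borel_measurable (PiM (K n) (\<lambda>_. borel :: ereal measure))"
          if "j \<le> n" "1 \<le> i" for i j
          using that by (intro measurable_component_singleton) (auto simp: K_def)
        from this[of 0 1] have [measurable]:
          "(\<lambda>x. x (k n, 1)) \<in> borel_measurable (PiM (K n) (\<lambda>_. borel :: ereal measure))" by simp
        show ?thesis unfolding P_def by measurable
      qed
    qed (auto simp: K_def P_def Q_def)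
    show "0 < p * c" using p(1) c(1) by simp
    show "p * c \<le> prob {\<omega>\<in>space M. Q n \<omega>}" for n
      unfolding Q_def prob_renewal_until[OF indep p(2) q(2)] using c(2) p(1) by (intro mult_left_mono) auto
  qed
  \<comment> \<open>First Borel-Cantelli lemma: a failure at lag \<open>Suc n\<close> or later has
    probability at most \<open>q ^ Suc n / (1 - q)\<close>, which is summable in
    \<open>n\<close>.\<close>
  moreover have "AE \<omega> in M. eventually (\<lambda>n. \<omega> \<in> space M - (\<Union>j. B (Suc n) j)) sequentially"
  proof (rule borel_cantelli_AE1)
    show "summable (\<lambda>n. prob (\<Union>j. B (Suc n) j))"
    proof (rule summable_comparison_test')
      show "summable (\<lambda>n. q ^ Suc n * (1 / (1 - q)))"
        using geom[of 1] by (intro summable_mult2) simp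
      show "norm (prob (\<Union>j. B (Suc n) j)) \<le> q ^ Suc n * (1 / (1 - q))" for n
      proof -
        have pB: "prob (B (Suc n) j) = q ^ (Suc n + j)" for j
          unfolding B_def using prob_all_below[OF indep q(2)] by blast
        have "prob (\<Union>j. B (Suc n) j) \<le> (\<Sum>j. prob (B (Suc n) j))"
          using B geom[of "Suc n"] by (intro finite_measure_subadditive_countably) (auto simp only: pB)
        also have "\<dots> = q ^ Suc n * (\<Sum>j. q ^ j)"
          unfolding pB power_add using q0 q(1) by (intro suminf_mult summable_geometric) auto
        also have "(\<Sum>j. q ^ j) = 1 / (1 - q)" using q0 q(1) by (intro suminf_geometric) auto
        finally show ?thesis by simp
      qed
    qed
  qed (use B in \<open>auto simp: less_top[symmetric]\<close>)
  ultimately show ?thesis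
  proof eventually_elim
    case (elim \<omega>)
    then obtain N where N: "\<And>n j. N \<le> n \<Longrightarrow> \<omega> \<in> space M \<and> \<omega> \<notin> B (Suc n) j"
      by (auto simp: eventually_sequentially)
    have "renewal (\<lambda>t j. w t j \<omega>) l (k n)" if Q: "Q n \<omega>" and n: "Suc N \<le> n" for n
    proof -
      have "\<exists>i\<in>{1..j}. ereal (1 - l) \<le> w (k n + int j) i \<omega>" if "1 \<le> j" for j
      proof (cases "j \<le> n")
        case True
        then show ?thesis using Q that by (simp add: Q_def)
      next
        case False
        then obtain i where "j = n + i" by (metis le_add_diff_inverse nat_le_linear)
        \<comment> \<open>\<open>N\<close> speaks of \<open>B (Suc n)\<close>, so candidate
          \<open>n\<close> is reached through \<open>n - 1\<close>; this is why \<open>n\<close>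
          starts at \<open>Suc N\<close>.\<close>
        then show ?thesis using N[of "n - 1" i] n by (auto simp: B_def not_less)
      qed
      then show ?thesis using Q by (simp add: renewal_def Q_def wbar_ge_iff)
    qed
    then have "{n. Q n \<omega>} \<subseteq> {n. renewal (\<lambda>t j. w t j \<omega>) l (k n)} \<union> {..N}"
      by (auto simp: not_less_eq_eq)
    then show ?case using elim(1) by (meson finite_UnI finite_atMost finite_subset)
  qed
qed

lemma AE_renewals_unbounded:
  fixes w :: "int \<Rightarrow> nat \<Rightarrow> 'a \<Rightarrow> ereal"
  assumes indep: "indep_vars (\<lambda>_. borel) (\<lambda>(t, j). w t j) (UNIV \<times> {1..})"
    and p: "0 < p" "\<And>t. prob {\<omega>\<in>space M. ereal l \<le> w t 1 \<omega>} = p"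
    and q: "q < 1" "\<And>t. \<forall>j\<ge>1. prob {\<omega>\<in>space M. w t j \<omega> < ereal (1 - l)} = q"
  shows "AE \<omega> in M. \<forall>n. (\<exists>k\<in>renewal_set (\<lambda>t j. w t j \<omega>) l. k < n) \<and> (\<exists>k\<in>renewal_set (\<lambda>t j. w t j \<omega>) l. n < k)"
proof -
  define k :: "nat \<Rightarrow> int" where "k n = int ((n + 1)\<^sup>2)" for n
  have step: "k n + int n < k m" if "n < m" for n m
  proof -
    have "(n + 2)\<^sup>2 \<le> (m + 1)\<^sup>2" using that by (intro power_mono) auto
    moreover have "(n + 1)\<^sup>2 + n < (n + 2)\<^sup>2" by (simp add: power2_eq_square)
    ultimately have "(n + 1)\<^sup>2 + n < (m + 1)\<^sup>2" by linarith
    then show ?thesis unfolding k_def by (simp only: of_nat_add[symmetric] of_nat_less_iff)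
  qed
  \<comment> \<open>At the mirrored times the window of \<open>- k m\<close> runs towards
    \<open>- k n\<close>, so the gap must exceed the longer length \<open>m\<close>. Already the gap
    between consecutive squares, \<open>2 * m + 1\<close>, does.\<close>
  have step': "k n + int m < k m" if "n < m" for n m
  proof -
    have "(n + 1)\<^sup>2 \<le> m\<^sup>2" using that by (intro power_mono) auto
    moreover have "m\<^sup>2 + m < (m + 1)\<^sup>2" by (simp add: power2_eq_square)
    ultimately have "(n + 1)\<^sup>2 + m < (m + 1)\<^sup>2" by linarith
    then show ?thesis unfolding k_def by (simp only: of_nat_add[symmetric] of_nat_less_iff)
  qed
  have large: "int n < k n" for n
    unfolding k_def of_nat_less_iff by (simp add: power2_eq_square)
  have "disjoint_family (\<lambda>n. {k n..k n + int n})"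
    unfolding disjoint_family_on_def
  proof (intro ballI impI)
    fix n m :: nat assume "n \<noteq> m"
    then show "{k n..k n + int n} \<inter> {k m..k m + int m} = {}"
      using step[of n m] step[of m n] by (cases "n < m") auto
  qed
  then have "AE \<omega> in M. infinite {n. renewal (\<lambda>t j. w t j \<omega>) l (k n)}"
    by (rule AE_infinitely_many_renewals[OF indep p q])
  moreover have "disjoint_family (\<lambda>n. {- k n..- k n + int n})"
    unfolding disjoint_family_on_def
  proof (intro ballI impI)
    fix n m :: nat assume "n \<noteq> m"
    then show "{- k n..- k n + int n} \<inter> {- k m..- k m + int m} = {}"
      using step'[of n m] step'[of m n] by (cases "n < m") auto
  qed
  then have "AE \<omega> in M. infinite {n. renewal (\<lambda>t j. w t j \<omega>) l (- k n)}"
    by (rule AE_infinitely_many_renewals[OF indep p q])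
  ultimately show ?thesis
  proof eventually_elim
    case (elim \<omega>)
    show ?case
    proof
      fix n :: int
      obtain i where "nat \<bar>n\<bar> < i" "renewal (\<lambda>t j. w t j \<omega>) l (k i)"
        using elim(1) by (auto simp: infinite_nat_iff_unbounded)
      moreover obtain i' where "nat \<bar>n\<bar> < i'" "renewal (\<lambda>t j. w t j \<omega>) l (- k i')"
        using elim(2) by (auto simp: infinite_nat_iff_unbounded)
      moreover have "n < k i" "- k i' < n" using large[of i] large[of i'] calculation by linarith+
      ultimately show "(\<exists>k\<in>renewal_set (\<lambda>t j. w t j \<omega>) l. k < n) \<and>
          (\<exists>k\<in>renewal_set (\<lambda>t j. w t j \<omega>) l. n < k)"
        unfolding renewal_set_def by blast
    qed
  qed
qed

end

section \<open>Starting from the last apparent renewal\<close>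

text \<open>The pathwise form of the claim. The last renewal time is at most \<open>T_star\<close>,
  so the evolution before \<open>T_star\<close> only supplies another initial measure, to which the
  coupling is insensitive.\<close>

lemma mbar_eq_from_T_star:
  assumes l: "0 \<le> l" "l < 1" and w: "\<And>t. \<forall>k\<ge>1. w t k \<le> 1"
    and unbounded: "\<And>n. \<exists>k\<in>renewal_set w l. k < n" "\<And>n. \<exists>k\<in>renewal_set w l. n < k"
  shows "\<bar>T_star w l\<bar> < \<infinity>"
    and "mbar w l 0 = max_charged
      (recentre (Psi_between w \<lfloor>real_of_ereal (T_star w l)\<rfloor> (-1) (return borel 0))) (w 0)"
proof -
  define r where "r = renewal_time w l (renewal_index w l (-1))"
  have "renewal w l r" "r \<le> -1"
    using last_renewal_time[OF unbounded, of "-1"] by (auto simp: r_def renewal_set_def)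
  then obtain t where t: "r \<le> t" "t \<le> -1" "T_star w l = ereal (of_int t)" "ereal l \<le> w t 1"
    and bar: "\<And>j. 1 \<le> j \<Longrightarrow> j \<le> nat \<bar>t\<bar> \<Longrightarrow> ereal (1 - l) \<le> wbar w t j"
    by (rule T_star_attained) (rule that)
  show "\<bar>T_star w l\<bar> < \<infinity>" using t(3) by simp
  \<comment> \<open>\<open>n\<close> steps after \<open>t\<close> lead to time -1, and the
    \<open>Suc n = nat \<bar>t\<bar>\<close> lags controlled by \<open>T_star\<close> are exactly
    those up to time 0.\<close>
  define n where "n = nat (-1 - t)"
  have n: "t + int n = -1" "t + int (Suc n) = 0" "Suc n = nat \<bar>t\<bar>" using t(2) by (auto simp: n_def)
  let ?\<delta> = "return borel 0 :: ereal measure"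
  have \<delta>: "sets ?\<delta> = sets borel" "\<bar>atom ?\<delta> 1\<bar> \<noteq> \<infinity>"
    using atom_return[of 0] by (auto simp: zero_ereal_def)
  have "mbar w l 0 = max_charged (recentre (Psi_between w t (-1) (Psi_between w r (t - 1) ?\<delta>))) (w 0)"
    using t by (simp add: mbar_def nu_tilde_def r_def[symmetric] Psi_between_split[of r t])
  also have "\<dots> = max_charged (recentre (Psi_between w t (-1) ?\<delta>)) (w 0)"
    using max_charged_recentre_coupling[where w=w and n=n, OF l w t(4) bar[folded n(3)] _ _ \<delta>,
        of "Psi_between w r (t - 1) ?\<delta>"]
      atom_Psi_between_1_finite[where w=w, OF \<delta>(1) w \<delta>(2)]
    unfolding n(1,2) by simp
  finally show "mbar w l 0 = max_charged
      (recentre (Psi_between w \<lfloor>real_of_ereal (T_star w l)\<rfloor> (-1) ?\<delta>)) (w 0)"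
    by (simp add: t(3))
qed

theorem theorem2:
  fixes M :: "'a measure" and F :: "ereal measure" and l :: real
    and w :: "int \<Rightarrow> nat \<Rightarrow> 'a \<Rightarrow> ereal"
  assumes "prob_space F" and "sets F = sets borel" and "emeasure F {\<infinity>} = 0"
    and "\<And>\<epsilon>::real. \<epsilon> > 0 \<Longrightarrow> emeasure F {ereal (1 - \<epsilon>)..1} > 0"
    and "emeasure F {1<..<\<infinity>} = 0"
    and "0 \<le> l" and "l < 1" and "emeasure F {ereal (1 - l)..1} > 0"
    and "prob_space M"
    and "prob_space.indep_vars M (\<lambda>_. borel) (\<lambda>(t, j). w t j) (UNIV \<times> {1..})"
    and "\<And>t j. 1 \<le> j \<Longrightarrow> distr M borel (w t j) = F"
  shows "(AE \<omega> in M. \<bar>T_star (\<lambda>t j. w t j \<omega>) l\<bar> < \<infinity>) \<and>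
    (AE \<omega> in M. mbar (\<lambda>t j. w t j \<omega>) l 0 =
       max_charged
         (recentre (Psi_between (\<lambda>t j. w t j \<omega>)
            \<lfloor>real_of_ereal (T_star (\<lambda>t j. w t j \<omega>) l)\<rfloor> (-1) (return borel 0)))
         (\<lambda>j. w 0 j \<omega>))"
proof -
  interpret prob_space M by fact
  interpret F: prob_space F by fact
  have indep: "indep_vars (\<lambda>_. borel) (\<lambda>(t, j). w t j) (UNIV \<times> {1..})" by fact
  have rv: "w t j \<in> borel_measurable M" if "1 \<le> j" for t j
    using indep that by (force simp: indep_vars_def)
  have distr: "prob {\<omega>\<in>space M. w t j \<omega> \<in> A} = measure F A" if "1 \<le> j" "A \<in> sets borel" for t j A
    using measure_distr[OF rv[OF that(1)] that(2)] assms(11)[OF that(1)]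
    by (simp add: vimage_def Int_def conj_commute)
  have pos: "0 < measure F {ereal a..}" if "0 < emeasure F {ereal a..1}" for a
  proof -
    have "emeasure F {ereal a..1} \<le> emeasure F {ereal a..}"
      using assms(2) by (intro emeasure_mono) auto
    with that have "0 < emeasure F {ereal a..}" by simp
    then show ?thesis by (simp add: F.emeasure_eq_measure)
  qed
  \<comment> \<open>The mass near 1 is used with \<epsilon> = \<open>1 - l\<close>, positive because
    \<open>l < 1\<close>.\<close>
  have p: "0 < measure F {ereal l..}" using assms(4)[of "1 - l"] assms(7) by (intro pos) simp
  have "measure F {..<ereal (1 - l)} = 1 - measure F {ereal (1 - l)..}"
    using assms(2) sets_eq_imp_space_eq[OF assms(2)] F.prob_compl[of "{ereal (1 - l)..}"]
    by (simp add: Compl_eq_Diff_UNIV[symmetric])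
  then have q: "measure F {..<ereal (1 - l)} < 1" using pos[OF assms(8)] by simp
  have "AE \<omega> in M. \<forall>n. (\<exists>k\<in>renewal_set (\<lambda>t j. w t j \<omega>) l. k < n) \<and>
      (\<exists>k\<in>renewal_set (\<lambda>t j. w t j \<omega>) l. n < k)"
  proof (rule AE_renewals_unbounded[OF indep p _ q])
    show "prob {\<omega>\<in>space M. ereal l \<le> w t 1 \<omega>} = measure F {ereal l..}" for t
      using distr[of 1 "{ereal l..}" t] by simp
    show "\<forall>j\<ge>1. prob {\<omega>\<in>space M. w t j \<omega> < ereal (1 - l)} = measure F {..<ereal (1 - l)}" for t
      using distr[of _ "{..<ereal (1 - l)}" t] by simp
  qed
  \<comment> \<open>The law \<open>F\<close> bounds each charge by 1 almost surely; countability of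
    the array gives one null set for all of them.\<close>
  moreover have "AE \<omega> in M. \<forall>t. \<forall>j\<in>{1..}. w t j \<omega> \<le> 1"
  proof -
    have "{1<..<\<infinity>} \<union> {\<infinity>} \<in> null_sets F"
      using assms(2,3,5) by (intro null_sets.Un null_setsI) auto
    moreover have "{x \<in> space F. \<not> x \<le> 1} \<subseteq> {1<..<\<infinity>} \<union> {\<infinity>}" by auto
    ultimately have "AE x in F. x \<le> 1" by (rule AE_I')
    then have "AE \<omega> in M. w t j \<omega> \<le> 1" if "1 \<le> j" for t j
      using AE_distrD[OF rv[OF that, of t], of "\<lambda>x. x \<le> 1"] unfolding assms(11)[OF that] by blast
    then show ?thesis by (auto simp: AE_all_countable AE_ball_countable)
  qed
  ultimately have "AE \<omega> in M. \<bar>T_star (\<lambda>t j. w t j \<omega>) l\<bar> < \<infinity> \<and> mbar (\<lambda>t j. w t j \<omega>) l 0 =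
      max_charged (recentre (Psi_between (\<lambda>t j. w t j \<omega>)
        \<lfloor>real_of_ereal (T_star (\<lambda>t j. w t j \<omega>) l)\<rfloor> (-1) (return borel 0))) (\<lambda>j. w 0 j \<omega>)"
  proof eventually_elim
    case (elim \<omega>)
    then have "\<And>t. \<forall>k\<ge>1. w t k \<omega> \<le> 1"
      and "\<And>n. \<exists>k\<in>renewal_set (\<lambda>t j. w t j \<omega>) l. k < n"
      and "\<And>n. \<exists>k\<in>renewal_set (\<lambda>t j. w t j \<omega>) l. n < k" by auto
    from mbar_eq_from_T_star[OF assms(6,7) this] show ?case by (rule conjI)
  qed
  then show ?thesis unfolding AE_conj_iff .
qed

end
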